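(* Let $\Gamma \subset \Gamma^\star \subset \mathrm{SL}(2,\mathbb{Z})$ be subgroups with $\Gamma$ of finite index in $\mathrm{SL}(2,\mathbb{Z})$. Suppose $u:\mathbb{H}\to\mathbb{C}$ is a classical Maass wave form with respect to $(\Gamma,k,v,\lambda)$ (so in particular $k\in\mathbb{R}$ and $|v(\gamma)|=1$ for all $\gamma\in\Gamma$). Suppose further that $u$ is a generalized Maass wave form with respect to $(\Gamma^\star,k,v^\star,\lambda)$, where $v^\star=v$ on $\Gamma$. Then $u$ is a classical Maass wave form with respect to $(\Gamma^\star,k,v^\star,\lambda)$. That is to say: $k\in\mathbb{R}$ and $|v^\star(\gamma)|=1$ for all $\gamma\in\Gamma$ imply that $|v^\star(\gamma)|=1$ for all $\gamma\in\Gamma^\star$.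
   Context: $\mathbb{H}=\{z=x+iy\in\mathbb{C}: y>0\}$, on which $\mathrm{SL}(2,\mathbb{R})$ acts by fractional linear transformations. Arguments are normalized by $\arg(w)\in(-\pi,\pi]$ for $w\neq 0$. For $k\in\mathbb{C}$, $\gamma=\begin{pmatrix}a&b\\c&d\end{pmatrix}\in\mathrm{SL}(2,\mathbb{R})$ and $f:\mathbb{H}\to\mathbb{C}$, put $(f|_k\gamma)(z)=e^{-ik\arg(cz+d)}f(\gamma z)$. Let $\Gamma\subset\mathrm{SL}(2,\mathbb{Z})$ have finite index. A multiplier (system) $v$ on $\Gamma$ compatible with weight $k\in\mathbb{C}$ is a function $v:\Gamma\to\mathbb{C}\setminus\{0\}$ such that $f(\gamma z)=v(\gamma)e^{ik\arg(cz+d)}f(z)$ (for all $\gamma=\begin{pmatrix}a&b\\c&d\end{pmatrix}\in\Gamma$, $z\in\mathbb{H}$) allows non-zero solutions $f$. This implies $$v(\gamma\delta)\,e^{ik\arg(c_{\gamma\delta}z+d_{\gamma\delta})}=v(\gamma)v(\delta)\,e^{ik\arg(c_\gamma(\delta z)+d_\gamma)}e^{ik\arg(c_\delta z+d_\delta)}$$ for all $\gamma,\delta\in\Gamma$, $z\in\mathbb{H}$, where $(c_\gamma,d_\gamma)$ is the bottom row of $\gamma$. The multiplier $v$ is unitary if $|v(\gamma)|=1$ for all $\gamma\in\Gamma$. $\mathcal{C}_\Gamma$ denotes a (finite) set of representatives of the inequivalent cusps of $\Gamma$. For each $q\in\mathcal{C}_\Gamma$, the stabilizer of $q$ is $\langle\gamma_q,-\mathbf{1}\rangle$,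 and $g_q\in\mathrm{SL}(2,\mathbb{Z})$ is a scaling matrix: $q=g_q\,i\infty$ and $g_q^{-1}\gamma_qg_q=\begin{pmatrix}1&l_q\\0&1\end{pmatrix}$, where the positive integer $l_q$ is the width of $q$. Laplace operator: $\Delta_k=-y^2(\partial_x^2+\partial_y^2)+iky\,\partial_x$. Classical Maass wave form with respect to $(\Gamma,k,v,\lambda)$: here $k\in\mathbb{R}$, $\lambda\in\mathbb{R}$ and $v$ is a unitary multiplier system on $\Gamma$ compatible with $k$; it is a real-analytic function $u:\mathbb{H}\to\mathbb{C}$ with (1) $u|_k\gamma=v(\gamma)u$ for all $\gamma\in\Gamma$; (2) $\Delta_ku=\lambda u$; (3) at each cusp $q\in\mathcal{C}_\Gamma$, $u(g_qz)=O(y^c)$ as $y\to\infty$ for some $c\in\mathbb{R}$. Generalized Maass wave form with respect to $(\Gamma,k,v,\lambda)$: here $k\in\mathbb{C}$, $\lambda\in\mathbb{C}$ and $v:\Gamma\to\mathbb{C}\setminus\{0\}$ is a (not necessarily unitary) multiplier system compatible with $k$; it is a real-analytic function $u:\mathbb{H}\to\mathbb{C}$ with (1) $u|_k\gamma=v(\gamma)u$ for all $\gamma\in\Gamma$; (2) $\Delta_ku=\lambda u$; (3) at each cusp $q\in\mathcal{C}_\Gamma$, $u(g_qz)=O(e^{cy})$ as $y\to\infty$ for some $c\in\mathbb{R}$. *)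

theory Defs
  imports "HOL-Analysis.Analysis" "HOL-Algebra.Coset" "HOL-Algebra.Generated_Groups"
    "HOL-Library.Landau_Symbols"
begin

definition upper_half_plane :: "complex set" where
  "upper_half_plane = {z. Im z > 0}"

definition SL2R :: "(real^2^2) monoid" where
  "SL2R = \<lparr>carrier = {A. det A = 1}, mult = (**), one = mat 1\<rparr>"

definition SL2Z :: "(real^2^2) monoid" where
  "SL2Z = SL2R\<lparr>carrier := {A. det A = 1 \<and> (\<forall>i j. A $ i $ j \<in> \<int>)}\<rparr>"

definition sl2_act :: "real^2^2 \<Rightarrow> complex \<Rightarrow> complex" where
  "sl2_act A = moebius (of_real (A$1$1)) (of_real (A$1$2)) (of_real (A$2$1)) (of_real (A$2$2))"

text \<open>The library's \<^const>\<open>Arg\<close> takes values in \<open>(-\<pi>, \<pi>]\<close>; the power \<open>k\<close> is complex.\<close>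

definition auto_factor :: "complex \<Rightarrow> real^2^2 \<Rightarrow> complex \<Rightarrow> complex" where
  "auto_factor k A z =
     exp (\<i> * k * of_real (Arg (of_real (A$2$1) * z + of_real (A$2$2))))"

definition slash :: "(complex \<Rightarrow> complex) \<Rightarrow> complex \<Rightarrow> real^2^2 \<Rightarrow> complex \<Rightarrow> complex" where
  "slash f k A z =
     exp (- \<i> * k * of_real (Arg (of_real (A$2$1) * z + of_real (A$2$2)))) * f (sl2_act A z)"

text \<open>
  Functions on the upper half-plane are represented by functions on all of \<open>\<complex>\<close>, and multipliers
  on \<open>\<Gamma>\<close> by functions on all real matrices; only the values on the upper half-plane, respectively
  on \<open>\<Gamma>\<close>, ever matter.
\<close>

definition multiplier_system :: "(real^2^2) set \<Rightarrow> complex \<Rightarrow> (real^2^2 \<Rightarrow> complex) \<Rightarrow> bool" where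
  "multiplier_system \<Gamma> k v \<longleftrightarrow>
     (\<forall>\<gamma>\<in>\<Gamma>. v \<gamma> \<noteq> 0) \<and>
     (\<exists>f :: complex \<Rightarrow> complex.
        (\<exists>z\<in>upper_half_plane. f z \<noteq> 0) \<and>
        (\<forall>\<gamma>\<in>\<Gamma>. \<forall>z\<in>upper_half_plane. f (sl2_act \<gamma> z) = v \<gamma> * auto_factor k \<gamma> z * f z))"

definition unitary_on :: "(real^2^2) set \<Rightarrow> (real^2^2 \<Rightarrow> complex) \<Rightarrow> bool" where
  "unitary_on \<Gamma> v \<longleftrightarrow> (\<forall>\<gamma>\<in>\<Gamma>. cmod (v \<gamma>) = 1)"

text \<open>
  Points of \<open>\<real> \<union> {i\<infinity>}\<close> are elements of \<^typ>\<open>real option\<close>, with \<^const>\<open>None\<close> standing for \<open>i\<infinity>\<close>.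
\<close>

fun boundary_act :: "real^2^2 \<Rightarrow> real option \<Rightarrow> real option" where
  "boundary_act A None = (if A$2$1 = 0 then None else Some (A$1$1 / A$2$1))"
| "boundary_act A (Some x) =
     (if A$2$1 * x + A$2$2 = 0 then None
      else Some ((A$1$1 * x + A$1$2) / (A$2$1 * x + A$2$2)))"

text \<open>
  All groups considered have finite index in \<^const>\<open>SL2Z\<close>, so their cusps are exactly the points of
  \<open>\<rat> \<union> {i\<infinity>}\<close>.
\<close>

definition cusps :: "real option set" where
  "cusps = insert None (Some ` \<rat>)"

definition cusp_representatives :: "(real^2^2) set \<Rightarrow> real option set \<Rightarrow> bool" where
  "cusp_representatives \<Gamma> C \<longleftrightarrow>
     finite C \<and> C \<subseteq> cusps \<and>
     (\<forall>q\<in>cusps. \<exists>!r. r \<in> C \<and> (\<exists>\<gamma>\<in>\<Gamma>. boundary_act \<gamma> q = r))"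

text \<open>
  The stabilizer is taken in \<open>{\<plusminus>1}\<Gamma>\<close>: the group generated by \<open>\<gamma>\<close> and \<open>-1\<close> is not contained in
  \<open>\<Gamma>\<close> itself unless \<open>-1 \<in> \<Gamma>\<close>.
\<close>

definition cusp_stabilizer :: "(real^2^2) set \<Rightarrow> real option \<Rightarrow> (real^2^2) set" where
  "cusp_stabilizer \<Gamma> q = {A. (A \<in> \<Gamma> \<or> - A \<in> \<Gamma>) \<and> boundary_act A q = q}"

definition scaling_matrix :: "(real^2^2) set \<Rightarrow> real option \<Rightarrow> real^2^2 \<Rightarrow> bool" where
  "scaling_matrix \<Gamma> q g \<longleftrightarrow>
     g \<in> carrier SL2Z \<and> boundary_act g None = q \<and>
     (\<exists>\<gamma> \<in> carrier SL2Z. \<exists>l::nat. l > 0 \<and>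
        cusp_stabilizer \<Gamma> q = generate SL2Z {\<gamma>, - mat 1} \<and>
        inv\<^bsub>SL2Z\<^esub> g \<otimes>\<^bsub>SL2Z\<^esub> \<gamma> \<otimes>\<^bsub>SL2Z\<^esub> g = vector [vector [1, real l], vector [0, 1]])"

definition cusp_data ::
  "(real^2^2) set \<Rightarrow> real option set \<Rightarrow> (real option \<Rightarrow> real^2^2) \<Rightarrow> bool" where
  "cusp_data \<Gamma> C g \<longleftrightarrow> cusp_representatives \<Gamma> C \<and> (\<forall>q\<in>C. scaling_matrix \<Gamma> q (g q))"

definition dx :: "(complex \<Rightarrow> complex) \<Rightarrow> complex \<Rightarrow> complex" where
  "dx f z = vector_derivative (\<lambda>t::real. f (z + of_real t)) (at 0)"

definition dy :: "(complex \<Rightarrow> complex) \<Rightarrow> complex \<Rightarrow> complex" where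
  "dy f z = vector_derivative (\<lambda>t::real. f (z + \<i> * of_real t)) (at 0)"

definition laplace :: "complex \<Rightarrow> (complex \<Rightarrow> complex) \<Rightarrow> complex \<Rightarrow> complex" where
  "laplace k f z =
     - of_real ((Im z)\<^sup>2) * (dx (dx f) z + dy (dy f) z) + \<i> * k * of_real (Im z) * dx f z"

text \<open>Real-analyticity in \<open>(x, y)\<close>: local expansion into a double power series.\<close>

definition real_analytic_on :: "(complex \<Rightarrow> complex) \<Rightarrow> complex set \<Rightarrow> bool" where
  "real_analytic_on f S \<longleftrightarrow>
     (\<forall>w\<in>S. \<exists>r>0. \<exists>a :: nat \<times> nat \<Rightarrow> complex. \<forall>z\<in>ball w r.
        ((\<lambda>(m, n). a (m, n) * of_real (Re (z - w) ^ m * Im (z - w) ^ n)) has_sum f z) UNIV)"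

text \<open>
  The growth conditions are uniform in \<open>x\<close>: the filter \<^term>\<open>filtercomap Im at_top\<close> expresses
  \<open>y \<rightarrow> \<infinity>\<close>. The chosen cusp representatives \<open>C\<close> and scaling matrices \<open>g\<close> are explicit
  parameters of the two notions of Maass wave form.
\<close>

definition maass_equations ::
  "(real^2^2) set \<Rightarrow> complex \<Rightarrow> (real^2^2 \<Rightarrow> complex) \<Rightarrow> complex \<Rightarrow> (complex \<Rightarrow> complex) \<Rightarrow> bool" where
  "maass_equations \<Gamma> k v lam u \<longleftrightarrow>
     real_analytic_on u upper_half_plane \<and>
     (\<forall>\<gamma>\<in>\<Gamma>. \<forall>z\<in>upper_half_plane. slash u k \<gamma> z = v \<gamma> * u z) \<and>
     (\<forall>z\<in>upper_half_plane. laplace k u z = lam * u z)"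

definition classical_maass_form ::
  "(real^2^2) set \<Rightarrow> real option set \<Rightarrow> (real option \<Rightarrow> real^2^2) \<Rightarrow>
   complex \<Rightarrow> (real^2^2 \<Rightarrow> complex) \<Rightarrow> complex \<Rightarrow> (complex \<Rightarrow> complex) \<Rightarrow> bool" where
  "classical_maass_form \<Gamma> C g k v lam u \<longleftrightarrow>
     k \<in> \<real> \<and> lam \<in> \<real> \<and> multiplier_system \<Gamma> k v \<and> unitary_on \<Gamma> v \<and>
     maass_equations \<Gamma> k v lam u \<and>
     (\<forall>q\<in>C. \<exists>c::real. (\<lambda>z. u (sl2_act (g q) z))
        \<in> O[filtercomap Im at_top](\<lambda>z. of_real (Im z powr c)))"

definition generalized_maass_form ::
  "(real^2^2) set \<Rightarrow> real option set \<Rightarrow> (real option \<Rightarrow> real^2^2) \<Rightarrow>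
   complex \<Rightarrow> (real^2^2 \<Rightarrow> complex) \<Rightarrow> complex \<Rightarrow> (complex \<Rightarrow> complex) \<Rightarrow> bool" where
  "generalized_maass_form \<Gamma> C g k v lam u \<longleftrightarrow>
     multiplier_system \<Gamma> k v \<and>
     maass_equations \<Gamma> k v lam u \<and>
     (\<forall>q\<in>C. \<exists>c::real. (\<lambda>z. u (sl2_act (g q) z))
        \<in> O[filtercomap Im at_top](\<lambda>z. of_real (exp (c * Im z))))"

lemma group_SL2R: "group SL2R"
proof (rule groupI)
  fix A assume A: "A \<in> carrier SL2R"
  have "invertible A" using A by (simp add: SL2R_def invertible_det_nz)
  then obtain B where m: "B ** A = mat 1" by (auto simp: invertible_def)
  then have "det B * det A = 1"
    by (metis det_I det_mul)
  then show "\<exists>B\<in>carrier SL2R. B \<otimes>\<^bsub>SL2R\<^esub> A = \<one>\<^bsub>SL2R\<^esub>"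
    using A m by (intro bexI[of _ B]) (auto simp: SL2R_def)
qed (auto simp: SL2R_def det_mul matrix_mul_assoc)

lemma subgroup_SL2Z: "subgroup (carrier SL2Z) SL2R"
proof (rule group.subgroupI[OF group_SL2R])
  show "carrier SL2Z \<subseteq> carrier SL2R" by (auto simp: SL2Z_def SL2R_def)
  have "mat 1 \<in> carrier SL2Z" by (simp add: SL2Z_def) (simp add: mat_def)
  then show "carrier SL2Z \<noteq> {}" by blast
next
  fix A assume A: "A \<in> carrier SL2Z"
  define B :: "real^2^2" where "B = vector [vector [A$2$2, - A$1$2], vector [- A$2$1, A$1$1]]"
  have B: "B $ 1 $ 1 = A$2$2" "B $ 1 $ 2 = - A$1$2" "B $ 2 $ 1 = - A$2$1" "B $ 2 $ 2 = A$1$1"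
    by (simp_all add: B_def)
  have d: "A$1$1 * A$2$2 - A$1$2 * A$2$1 = 1"
    using A by (simp add: SL2Z_def det_2)
  have BA: "B ** A = mat 1"
    using d by (simp add: vec_eq_iff forall_2 matrix_matrix_mult_def sum_2 B mat_def algebra_simps)
  have "B \<in> carrier SL2Z"
    using A d by (auto simp: SL2Z_def det_2 B forall_2 algebra_simps)
  moreover have "inv\<^bsub>SL2R\<^esub> A = B"
    by (rule group.inv_equality[OF group_SL2R])
       (use A BA calculation in \<open>auto simp: SL2Z_def SL2R_def\<close>)
  ultimately show "inv\<^bsub>SL2R\<^esub> A \<in> carrier SL2Z" by simp
next
  fix A B assume "A \<in> carrier SL2Z" "B \<in> carrier SL2Z"
  then show "A \<otimes>\<^bsub>SL2R\<^esub> B \<in> carrier SL2Z"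
    unfolding SL2Z_def SL2R_def by (simp add: det_mul) (auto simp: matrix_matrix_mult_def)
qed

lemma group_SL2Z: "group SL2Z"
  using subgroup.subgroup_is_group[OF subgroup_SL2Z group_SL2R]
  by (simp add: SL2Z_def)

end

theory Submission imports Defs
begin

text \<open>
  The multiplier \<open>v'\<close> fails to be a character only by the factors \<open>exp (i k arg (c z + d))\<close>, and
  these have absolute value 1 because \<open>k\<close> is real. Hence \<open>\<bar>v'\<bar>\<close> is a homomorphism from \<open>\<Gamma>'\<close> to
  the positive reals (\<open>multiplier_system_norm_mult\<close>). It is trivial on \<open>\<Gamma>\<close>, so it is
  constant on each of finitely many cosets; but the powers of a positive real other than 1 are pairwise distinct, so
  \<open>\<bar>v'\<bar>\<close> is trivial (\<open>positive_character_trivial_of_finite_index\<close>).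

  Polynomial growth at a cusp \<open>q\<close> of \<open>\<Gamma>'\<close> comes from the growth at the representative \<open>r\<close> of \<open>q\<close>
  modulo the smaller group \<open>\<Gamma>\<close>. If \<open>\<gamma> \<in> \<Gamma>\<close> sends \<open>q\<close> to \<open>r\<close>, then \<open>\<gamma> g'\<^sub>q\<close> and \<open>g\<^sub>r\<close> both send
  \<open>i\<infinity>\<close> to \<open>r\<close>, so they differ by a horizontal translation \<open>z \<mapsto> z + t\<close>
  (\<open>sl2_act_eq_translate_if_same_cusp\<close>). As \<open>\<bar>u\<bar>\<close> is invariant under \<open>\<Gamma>\<close>, this gives
  \<open>\<bar>u (g'\<^sub>q z)\<bar> = \<bar>u (g\<^sub>r (z + t))\<bar>\<close>, and the growth condition only depends on \<open>Im z\<close>.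
\<close>

section \<open>Positive characters trivial on a subgroup of finite index\<close>

lemma (in group) positive_character_trivial_of_finite_index:
  fixes \<phi> :: "'a \<Rightarrow> real"
  assumes H: "subgroup H G" and K: "subgroup K G" and HK: "H \<subseteq> K"
    and fin: "finite (rcosets H)"
    and mult: "\<And>x y. x \<in> K \<Longrightarrow> y \<in> K \<Longrightarrow> \<phi> (x \<otimes> y) = \<phi> x * \<phi> y"
    and pos: "\<And>x. x \<in> K \<Longrightarrow> \<phi> x > 0"
    and triv: "\<And>x. x \<in> H \<Longrightarrow> \<phi> x = 1"
    and x: "x \<in> K"
  shows "\<phi> x = 1"
proof -
  have xG: "x \<in> carrier G" using K x by (rule subgroup.mem_carrier)
  have powK: "x [^] n \<in> K" for n :: nat
    by (induction n) (use K x in \<open>auto simp: subgroup.one_closed subgroup.m_closed\<close>)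
  have pow: "\<phi> (x [^] n) = \<phi> x ^ n" for n :: nat
    by (induction n)
       (use triv[of \<one>] subgroup.one_closed[OF H] powK x in \<open>auto simp: mult mult.commute\<close>)
  have "range (\<lambda>n::nat. H #> x [^] n) \<subseteq> rcosets H"
    using subgroup.subset[OF H] xG by (auto intro: rcosetsI)
  then have "\<not> inj (\<lambda>n::nat. H #> x [^] n)"
    using fin finite_subset finite_imageD by blast
  then obtain m n :: nat where mn: "m \<noteq> n" and eq: "H #> x [^] m = H #> x [^] n"
    by (auto simp: inj_on_def)
  have "x [^] m \<in> H #> x [^] n"
    using eq rcos_self[OF _ H, of "x [^] m"] xG by simp
  then obtain h where h: "h \<in> H" and "x [^] m = h \<otimes> x [^] n"
    by (auto simp: r_coset_def)
  then have "\<phi> (x [^] m) = \<phi> (x [^] n)"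
    using mult[of h "x [^] n"] triv[OF h] HK powK by auto
  then have "\<phi> x ^ m = \<phi> x ^ n" by (simp add: pow)
  then show ?thesis
    using mn pos[OF x] power_inject_exp'[of "\<phi> x" m n] by auto
qed

section \<open>The action on the upper half-plane and on its boundary\<close>

lemma carrier_SL2Z_det: "A \<in> carrier SL2Z \<Longrightarrow> A$1$1 * A$2$2 - A$1$2 * A$2$1 = 1"
  by (simp add: SL2Z_def det_2)

lemma mult_SL2Z: "A \<otimes>\<^bsub>SL2Z\<^esub> B = A ** B"
  by (simp add: SL2Z_def SL2R_def)

lemma matrix_mult_2_nth: "((A::real^2^2) ** B) $ i $ j = A$i$1 * B$1$j + A$i$2 * B$2$j"
  by (simp add: matrix_matrix_mult_def sum_2)

lemma sl2_denominator_nonzero: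
  assumes "A \<in> carrier SL2Z" "z \<in> upper_half_plane"
  shows "complex_of_real (A$2$1) * z + of_real (A$2$2) \<noteq> 0"
  using carrier_SL2Z_det[OF assms(1)] assms(2)
  by (auto simp: complex_eq_iff upper_half_plane_def)

lemma sl2_act_upper_half_plane:
  assumes A: "A \<in> carrier SL2Z" and z: "z \<in> upper_half_plane"
  shows "sl2_act A z \<in> upper_half_plane"
proof -
  define w where "w = complex_of_real (A$2$1) * z + of_real (A$2$2)"
  have w: "w \<noteq> 0" using sl2_denominator_nonzero[OF A z] by (simp add: w_def)
  have num: "Im (complex_of_real (A$1$1) * z + of_real (A$1$2)) * Re w
      - Re (complex_of_real (A$1$1) * z + of_real (A$1$2)) * Im w
      = (A$1$1 * A$2$2 - A$1$2 * A$2$1) * Im z"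
    by (simp add: w_def algebra_simps)
  have "Im (sl2_act A z) = Im z / ((Re w)\<^sup>2 + (Im w)\<^sup>2)"
    unfolding sl2_act_def moebius_def w_def[symmetric] Im_divide num carrier_SL2Z_det[OF A] by simp
  moreover have "(Re w)\<^sup>2 + (Im w)\<^sup>2 > 0"
    using w by (simp add: complex_eq_iff sum_power2_gt_zero_iff)
  ultimately show ?thesis using z by (simp add: upper_half_plane_def)
qed

lemma sl2_act_mult:
  assumes B: "B \<in> carrier SL2Z" and z: "z \<in> upper_half_plane"
  shows "sl2_act (A ** B) z = sl2_act A (sl2_act B z)"
proof -
  define w where "w = complex_of_real (B$2$1) * z + of_real (B$2$2)"
  define n where "n = complex_of_real (B$1$1) * z + of_real (B$1$2)"
  have w: "w \<noteq> 0" using sl2_denominator_nonzero[OF B z] by (simp add: w_def)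
  have lin: "complex_of_real (a * B$1$1 + b * B$2$1) * z + of_real (a * B$1$2 + b * B$2$2)
      = (of_real a * (n / w) + of_real b) * w" for a b
    using w by (simp add: field_simps) (simp add: n_def w_def algebra_simps)
  show ?thesis
    unfolding sl2_act_def moebius_def matrix_mult_2_nth lin n_def[symmetric] w_def[symmetric]
    using w by simp
qed

lemma boundary_act_mult_None:
  assumes A: "A \<in> carrier SL2Z" and B: "B \<in> carrier SL2Z"
  shows "boundary_act (A ** B) None = boundary_act A (boundary_act B None)"
proof (cases "B$2$1 = 0")
  case True
  then have "B$1$1 \<noteq> 0" using carrier_SL2Z_det[OF B] by auto
  then show ?thesis using True by (simp add: matrix_mult_2_nth)
next
  case False
  have "a * B$1$1 + b * B$2$1 = (a * (B$1$1 / B$2$1) + b) * B$2$1" for a b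
    using False by (simp add: field_simps)
  with False show ?thesis by (simp add: matrix_mult_2_nth)
qed

text \<open>
  The image of \<open>i\<infinity>\<close> is the slope of the first column, so \<open>A\<inverse> B\<close> is upper triangular when \<open>A\<close> and
  \<open>B\<close> have the same image. Its diagonal entries are integers with product 1, hence equal, and it
  acts as a translation. Integrality matters: real matrices would also allow dilations.
\<close>

lemma sl2_act_eq_translate_if_same_cusp:
  assumes A: "A \<in> carrier SL2Z" and B: "B \<in> carrier SL2Z"
    and eq: "boundary_act A None = boundary_act B None"
  obtains t :: real
    where "\<And>z. z \<in> upper_half_plane \<Longrightarrow> sl2_act B z = sl2_act A (z + of_real t)"
proof -
  interpret group SL2Z by (rule group_SL2Z)
  define D where "D = inv\<^bsub>SL2Z\<^esub> A \<otimes>\<^bsub>SL2Z\<^esub> B"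
  have D: "D \<in> carrier SL2Z" using A B by (simp add: D_def)
  have AD: "B = A ** D"
    using inv_solve_left[OF D A B] D_def by (simp add: mult_SL2Z)
  have "boundary_act D None = boundary_act (inv\<^bsub>SL2Z\<^esub> A ** A) None"
    using boundary_act_mult_None[OF inv_closed[OF A] A] boundary_act_mult_None[OF inv_closed[OF A] B]
    unfolding D_def mult_SL2Z eq by (rule trans[OF _ sym, rotated])
  also have "inv\<^bsub>SL2Z\<^esub> A ** A = mat 1"
    using l_inv[OF A] unfolding mult_SL2Z by (simp add: SL2Z_def SL2R_def)
  finally have D21: "D$2$1 = 0" by (auto simp: mat_def split: if_splits)
  have dd: "D$1$1 * D$2$2 = 1" using carrier_SL2Z_det[OF D] D21 by simp
  have "D$1$1 \<in> \<int>" "D$2$2 \<in> \<int>" using D by (auto simp: SL2Z_def)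
  then obtain a d :: int where ad: "D$1$1 = of_int a" "D$2$2 = of_int d"
    by (auto elim!: Ints_cases)
  have "a * d = 1" using dd ad by (metis of_int_eq_1_iff of_int_mult)
  then have "a = d" using zmult_eq_1_iff by auto
  then have diag: "D$1$1 = D$2$2" using ad by simp
  have D22: "D$2$2 \<noteq> 0" using dd by auto
  have "sl2_act D z = z + of_real (D$1$2 / D$2$2)" for z
    using D22 by (simp add: sl2_act_def moebius_def D21 diag field_simps)
  then show ?thesis
    using that[of "D$1$2 / D$2$2"] sl2_act_mult[OF D] AD by simp
qed

section \<open>Absolute values in real weight\<close>

lemma norm_auto_factor: "k \<in> \<real> \<Longrightarrow> cmod (auto_factor k A z) = 1"
  by (auto simp: auto_factor_def elim!: Reals_cases)

lemma norm_slash: "k \<in> \<real> \<Longrightarrow> cmod (slash f k A z) = cmod (f (sl2_act A z))"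
  by (auto simp: slash_def norm_mult elim!: Reals_cases)

text \<open>
  Compatibility with the weight provides a function \<open>f\<close> whose absolute value scales by \<open>\<bar>v A\<bar>\<close>
  under \<open>A\<close>. Computing \<open>\<bar>f (A B z)\<bar>\<close> in two ways at a point where \<open>f\<close> does not vanish gives
  multiplicativity without handling the arguments in the cocycle relation.
\<close>

lemma multiplier_system_norm_mult:
  assumes v: "multiplier_system \<Gamma> k v" and \<Gamma>: "subgroup \<Gamma> SL2Z" and k: "k \<in> \<real>"
    and A: "A \<in> \<Gamma>" and B: "B \<in> \<Gamma>"
  shows "cmod (v (A ** B)) = cmod (v A) * cmod (v B)"
proof -
  obtain f z where z: "z \<in> upper_half_plane" and nz: "f z \<noteq> 0"
    and f: "\<And>A z. A \<in> \<Gamma> \<Longrightarrow> z \<in> upper_half_plane \<Longrightarrow>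
      f (sl2_act A z) = v A * auto_factor k A z * f z"
    using v unfolding multiplier_system_def by blast
  have norm: "cmod (f (sl2_act A z)) = cmod (v A) * cmod (f z)"
    if "A \<in> \<Gamma>" "z \<in> upper_half_plane" for A z
    using f[OF that] norm_auto_factor[OF k] by (simp add: norm_mult)
  have Bc: "B \<in> carrier SL2Z" using \<Gamma> B by (rule subgroup.mem_carrier)
  have AB: "A ** B \<in> \<Gamma>" using subgroup.m_closed[OF \<Gamma> A B] by (simp add: mult_SL2Z)
  have "cmod (v (A ** B)) * cmod (f z) = cmod (f (sl2_act A (sl2_act B z)))"
    using norm[OF AB z] sl2_act_mult[OF Bc z] by simp
  also have "\<dots> = cmod (v A) * cmod (v B) * cmod (f z)"
    using norm[OF A sl2_act_upper_half_plane[OF Bc z]] norm[OF B z] by simp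
  finally show ?thesis using nz by simp
qed

lemma maass_equations_norm_invariant:
  assumes u: "maass_equations \<Gamma> k v lam u" and v: "unitary_on \<Gamma> v" and k: "k \<in> \<real>"
    and A: "A \<in> \<Gamma>" and z: "z \<in> upper_half_plane"
  shows "cmod (u (sl2_act A z)) = cmod (u z)"
proof -
  have "slash u k A z = v A * u z" using u A z by (auto simp: maass_equations_def)
  then show ?thesis
    using norm_slash[OF k, of u A z] v A by (simp add: unitary_on_def norm_mult)
qed

section \<open>Growth at the cusps of the larger group\<close>

text \<open>
  The growth conditions are uniform in \<open>Re z\<close>, so a horizontal translation does not affect them.
\<close>

lemma filterlim_translate_Im_at_top:
  "filterlim (\<lambda>z. z + of_real t) (filtercomap Im at_top) (filtercomap Im at_top)"
  by (simp add: filterlim_filtercomap_iff o_def filterlim_filtercomap)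

lemma classical_growth_at_every_cusp:
  assumes \<Gamma>: "subgroup \<Gamma> SL2Z" and C: "cusp_data \<Gamma> C g"
    and u: "classical_maass_form \<Gamma> C g k v lam u"
    and q: "boundary_act h None \<in> cusps" and h: "h \<in> carrier SL2Z"
  shows "\<exists>c::real. (\<lambda>z. u (sl2_act h z)) \<in> O[filtercomap Im at_top](\<lambda>z. of_real (Im z powr c))"
proof -
  let ?F = "filtercomap Im at_top :: complex filter"
  obtain r A where r: "r \<in> C" and A: "A \<in> \<Gamma>"
    and Aq: "boundary_act A (boundary_act h None) = r"
    using C q unfolding cusp_data_def cusp_representatives_def by blast
  have gr: "g r \<in> carrier SL2Z" "boundary_act (g r) None = r"
    using C r by (auto simp: cusp_data_def scaling_matrix_def)
  have Ac: "A \<in> carrier SL2Z" using \<Gamma> A by (rule subgroup.mem_carrier)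
  have Ah: "A ** h \<in> carrier SL2Z"
    using monoid.m_closed[OF group.is_monoid[OF group_SL2Z] Ac h] by (simp add: mult_SL2Z)
  have "boundary_act (g r) None = boundary_act (A ** h) None"
    using boundary_act_mult_None[OF Ac h] Aq gr(2) by simp
  then obtain t :: real
    where t: "\<And>z. z \<in> upper_half_plane \<Longrightarrow> sl2_act (A ** h) z = sl2_act (g r) (z + of_real t)"
    using sl2_act_eq_translate_if_same_cusp[OF gr(1) Ah] by blast
  obtain c where "(\<lambda>z. u (sl2_act (g r) z)) \<in> O[?F](\<lambda>z. of_real (Im z powr c))"
    using u r by (auto simp: classical_maass_form_def)
  from landau_o.big.compose[OF this filterlim_translate_Im_at_top[of t]]
  have tr: "(\<lambda>z. u (sl2_act (g r) (z + of_real t))) \<in> O[?F](\<lambda>z. of_real (Im z powr c))"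
    by simp
  have norm_eq: "cmod (u (sl2_act h z)) = cmod (u (sl2_act (g r) (z + of_real t)))"
    if z: "z \<in> upper_half_plane" for z
  proof -
    have "cmod (u (sl2_act h z)) = cmod (u (sl2_act A (sl2_act h z)))"
      using u sl2_act_upper_half_plane[OF h z] A
      by (auto simp: classical_maass_form_def maass_equations_norm_invariant)
    then show ?thesis using sl2_act_mult[OF h z, of A] t[OF z] by simp
  qed
  have "eventually (\<lambda>z. z \<in> upper_half_plane) ?F"
    unfolding upper_half_plane_def mem_Collect_eq
    by (intro eventually_filtercomapI eventually_gt_at_top)
  then have "eventually (\<lambda>z. cmod (u (sl2_act h z))
      \<le> cmod (u (sl2_act (g r) (z + of_real t)))) ?F"
    by eventually_elim (simp add: norm_eq)
  from landau_o.big_trans[OF landau_o.big_mono[OF this] tr] show ?thesis by blast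
qed

theorem lemma2p5:
  fixes \<Gamma> \<Gamma>' :: "(real^2^2) set"
    and C C' :: "real option set"
    and g g' :: "real option \<Rightarrow> real^2^2"
    and k lam :: complex
    and v v' :: "real^2^2 \<Rightarrow> complex"
    and u :: "complex \<Rightarrow> complex"
  assumes "subgroup \<Gamma> SL2Z" and "subgroup \<Gamma>' SL2Z" and "\<Gamma> \<subseteq> \<Gamma>'"
    and "finite (rcosets\<^bsub>SL2Z\<^esub> \<Gamma>)"
    and "cusp_data \<Gamma> C g" and "cusp_data \<Gamma>' C' g'"
    and "classical_maass_form \<Gamma> C g k v lam u"
    and "generalized_maass_form \<Gamma>' C' g' k v' lam u"
    and "\<forall>\<gamma>\<in>\<Gamma>. v' \<gamma> = v \<gamma>"
  shows "classical_maass_form \<Gamma>' C' g' k v' lam u \<and>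
    (\<forall>\<gamma>\<in>\<Gamma>'. cmod (v' \<gamma>) = 1)"
proof -
  have k: "k \<in> \<real>" and lam: "lam \<in> \<real>" and v: "unitary_on \<Gamma> v"
    using assms(7) by (auto simp: classical_maass_form_def)
  have v': "multiplier_system \<Gamma>' k v'" and eqs: "maass_equations \<Gamma>' k v' lam u"
    using assms(8) by (auto simp: generalized_maass_form_def)
  have unitary: "cmod (v' \<gamma>) = 1" if "\<gamma> \<in> \<Gamma>'" for \<gamma>
  proof (rule group.positive_character_trivial_of_finite_index
      [OF group_SL2Z assms(1-4), where \<phi> = "\<lambda>\<gamma>. cmod (v' \<gamma>)"])
    show "cmod (v' (A \<otimes>\<^bsub>SL2Z\<^esub> B)) = cmod (v' A) * cmod (v' B)" if "A \<in> \<Gamma>'" "B \<in> \<Gamma>'" for A B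
      using multiplier_system_norm_mult[OF v' assms(2) k that] by (simp add: mult_SL2Z)
    show "cmod (v' A) > 0" if "A \<in> \<Gamma>'" for A
      using v' that by (auto simp: multiplier_system_def)
    show "cmod (v' A) = 1" if "A \<in> \<Gamma>" for A
      using assms(9) v that by (auto simp: unitary_on_def)
  qed (fact that)
  have growth: "\<exists>c::real. (\<lambda>z. u (sl2_act (g' q) z))
      \<in> O[filtercomap Im at_top](\<lambda>z. of_real (Im z powr c))" if "q \<in> C'" for q
    using assms(6) that
    by (intro classical_growth_at_every_cusp[OF assms(1,5,7)])
       (auto simp: cusp_data_def cusp_representatives_def scaling_matrix_def)
  show ?thesis
    unfolding classical_maass_form_def unitary_on_def
    using k lam v' eqs unitary growth by blast
qed

end
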